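(* Let $g:\mathbb{R}^n\times\Delta\to\mathbb{R}^r$ be of the separable form $$g(x,\delta) = G(x)\,q(\delta) + H(x) + s(\delta),$$ where $G:\mathbb{R}^n\to\mathbb{R}^{r\times m}$, $q:\Delta\to\mathbb{R}^m$, $H:\mathbb{R}^n\to\mathbb{R}^r$ and $s:\Delta\to\mathbb{R}^r$, and suppose the standing regularity assumption (see context) holds. Then the scenario program $\mathrm{SP}[\omega]$ with constraint function $g$ satisfies $|\mathrm{sc}(\mathrm{SP}[\omega])| \le r(m+1)$ almost surely.
   Context: Setting. $(\Delta,\mathcal{F},\mathbb{P})$ is a probability space with $\Delta\subseteq\mathbb{R}^d$; $\mathcal{X}\subset\mathbb{R}^n$ is a compact convex set; $c\in\mathbb{R}^n$. Vector inequalities are understood element-wise. Given a multi-sample $\omega=\{\delta^{(1)},\ldots,\delta^{(N)}\}\in\Delta^N$ of i.i.d. samples drawn according to $\mathbb{P}$, the scenario program is $$\mathrm{SP}[\omega]:\quad \min_{x\in\mathcal{X}} c^\top x \quad\text{s.t.}\quad g(x,\delta^{(j)})\le 0\ \ \forall j\in\{1,\ldots,N\}.$$ Standing regularity assumption. For almost all $\delta\in\Delta$, the function $x\mapsto g(x,\delta)$ is convex and lower semi-continuous (componentwise). For any integer $N$, $\mathrm{SP}[\omega]$ is almost surely feasible, and its optimizer exists and is unique for almost all $\omega\in\Delta^N$. For all $x\in\mathcal{X}$, the mapping $\delta\mapsto g(x,\delta)$ is measurable. Support constraints. Let $x^\star$ be the minimizer of $\mathrm{SP}[\omega]$ and, for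 $k\in\{1,\ldots,N\}$, let $x_k^\star$ be the minimizer of $\mathrm{SP}[\omega\setminus\{\delta^{(k)}\}]$ (the program with the $k$-th sample removed). The sample $\delta^{(k)}$ is a support sample, and $g(\cdot,\delta^{(k)})\le 0$ a support constraint, if $c^\top x_k^\star<c^\top x^\star$. $\mathrm{sc}(\mathrm{SP}[\omega])$ is the set of support constraints and $|\mathrm{sc}(\mathrm{SP}[\omega])|$ its cardinality (the number of such indices $k$). "Almost surely" refers to the product measure $\mathbb{P}^N$ on $\Delta^N$, for any number $N$ of samples. *)

theory Defs
  imports "HOL-Probability.Probability_Measure"
begin

definition lower_semicontinuous :: "('a::topological_space \<Rightarrow> real) \<Rightarrow> bool" where
  "lower_semicontinuous f \<longleftrightarrow> (\<forall>x. \<forall>a < f x. \<forall>\<^sub>F y in at x. a < f y)"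

text \<open>
  A multi-sample is a family \<open>\<omega>\<close> of samples, of which a program uses those with index in a
  finite set \<open>J\<close>: \<open>J = {1..N}\<close> gives the full scenario program, and removing the
  \<open>k\<close>-th sample means replacing \<open>J\<close> by \<open>J - {k}\<close>. Working with indices keeps
  samples that happen to have equal values apart. The order on vectors is componentwise.
\<close>

definition scenario_feasible ::
    "(real^'n) set \<Rightarrow> (real^'n \<Rightarrow> 'd \<Rightarrow> real^'r) \<Rightarrow> nat set \<Rightarrow> (nat \<Rightarrow> 'd) \<Rightarrow> (real^'n) set" where
  "scenario_feasible X g J \<omega> = {x \<in> X. \<forall>j\<in>J. g x (\<omega> j) \<le> 0}"

definition scenario_minimizer ::
    "real^'n \<Rightarrow> (real^'n) set \<Rightarrow> (real^'n \<Rightarrow> 'd \<Rightarrow> real^'r) \<Rightarrow> nat set \<Rightarrow> (nat \<Rightarrow> 'd)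
      \<Rightarrow> real^'n \<Rightarrow> bool" where
  "scenario_minimizer c X g J \<omega> x \<longleftrightarrow>
     is_arg_min (\<lambda>y. c \<bullet> y) (\<lambda>y. y \<in> scenario_feasible X g J \<omega>) x"

text \<open>
  All minimizers of a program have the same cost, so the choice of \<open>x\<close> and \<open>xk\<close> below is
  immaterial.
\<close>

definition support_constraints ::
    "real^'n \<Rightarrow> (real^'n) set \<Rightarrow> (real^'n \<Rightarrow> 'd \<Rightarrow> real^'r) \<Rightarrow> nat set \<Rightarrow> (nat \<Rightarrow> 'd)
      \<Rightarrow> nat set" where
  "support_constraints c X g J \<omega> =
     {k \<in> J. \<exists>x xk. scenario_minimizer c X g J \<omega> x \<and>
        scenario_minimizer c X g (J - {k}) \<omega> xk \<and> c \<bullet> xk < c \<bullet> x}"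

end

theory Submission
  imports Defs "HOL-Probability.Infinite_Product_Measure"
begin

text \<open>
  Classically, a convex program in a \<open>D\<close>-dimensional variable has at most \<open>D\<close> support
  constraints, by Helly's theorem. Here the variable \<open>x\<close> is replaced by \<open>w = (G x, H x)\<close>, of
  dimension \<open>D = r (m + 1)\<close>, in which every sampled constraint
  \<open>U q(\<delta>) + v + s(\<delta>) \<le> 0\<close>, with \<open>w = (U, v)\<close>, is affine. The image of \<open>X\<close> under
  \<open>(G, H)\<close> need not be convex, so it is relaxed to the set of those \<open>w\<close> for which some
  \<open>x \<in> X\<close> has \<open>G x q(\<delta>) + H x \<le> U q(\<delta>) + v\<close> at all samples. This set is convex because
  \<open>g\<close> is convex in \<open>x\<close>, and the relaxation is harmless because such an \<open>x\<close> satisfies every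
  sampled constraint that \<open>w\<close> satisfies.
\<close>

text \<open>Any \<open>DIM('a) + 1\<close> members leave out some \<open>A\<close>, so they share
  the points of \<open>\<Inter>(F - {A})\<close>, and Helly's theorem applies.\<close>

lemma Inter_nonempty_of_deletions:
  fixes F :: "('a::euclidean_space) set set"
  assumes card: "card F = DIM('a) + 2"
    and "\<And>A. A \<in> F \<Longrightarrow> convex A"
    and del: "\<And>A. A \<in> F \<Longrightarrow> \<Inter>(F - {A}) \<noteq> {}"
  shows "\<Inter>F \<noteq> {}"
proof (rule Helly)
  fix T assume T: "T \<subseteq> F" "card T = DIM('a) + 1"
  then obtain A where A: "A \<in> F" "A \<notin> T"
    using card by (metis Suc_eq_plus1 add_2_eq_Suc' n_not_Suc_n subsetI subset_antisym)
  then have "\<Inter>(F - {A}) \<subseteq> \<Inter>T"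
    using T by (intro Inter_anti_mono) auto
  then show "\<Inter>T \<noteq> {}"
    using del[OF A(1)] by auto
qed (use assms in auto)

text \<open>If \<open>x\<close> and \<open>y\<close> are witnesses for \<open>w\<close> and
  \<open>z\<close>, their convex combination is a witness for that of \<open>w\<close> and
  \<open>z\<close>: convexity is needed only for the composite with \<open>\<Phi>\<close>, not for
  \<open>\<Phi>\<close> or its image.\<close>

lemma convex_relaxation:
  fixes \<Phi> :: "real^'n \<Rightarrow> 'w::real_vector" and A :: "nat \<Rightarrow> 'w \<Rightarrow> real^'r"
  assumes "convex X"
    and lin: "\<And>j. j \<in> J \<Longrightarrow> linear (A j)"
    and cvx: "\<And>j i. j \<in> J \<Longrightarrow> convex_on UNIV (\<lambda>x. (A j (\<Phi> x) + b j) $ i)"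
  shows "convex {w. \<exists>x\<in>X. c \<bullet> x < \<gamma> \<and> (\<forall>j\<in>J. A j (\<Phi> x) \<le> A j w)}"
proof (rule convexI)
  fix w z and u v :: real
  assume uv: "0 \<le> u" "0 \<le> v" "u + v = 1"
  assume "w \<in> {w. \<exists>x\<in>X. c \<bullet> x < \<gamma> \<and> (\<forall>j\<in>J. A j (\<Phi> x) \<le> A j w)}"
  then obtain x where x: "x \<in> X" "c \<bullet> x < \<gamma>" "\<And>j. j \<in> J \<Longrightarrow> A j (\<Phi> x) \<le> A j w"
    by auto
  assume "z \<in> {w. \<exists>x\<in>X. c \<bullet> x < \<gamma> \<and> (\<forall>j\<in>J. A j (\<Phi> x) \<le> A j w)}"
  then obtain y where y: "y \<in> X" "c \<bullet> y < \<gamma>" "\<And>j. j \<in> J \<Longrightarrow> A j (\<Phi> y) \<le> A j z"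
    by auto
  have "u *\<^sub>R x + v *\<^sub>R y \<in> X"
    using \<open>convex X\<close> x y uv by (simp add: convexD)
  moreover have "c \<bullet> (u *\<^sub>R x + v *\<^sub>R y) < \<gamma>"
    using convex_bound_lt[OF x(2) y(2) uv] by (simp add: inner_add_right)
  moreover have "A j (\<Phi> (u *\<^sub>R x + v *\<^sub>R y)) \<le> A j (u *\<^sub>R w + v *\<^sub>R z)" if "j \<in> J" for j
  proof -
    have "A j (\<Phi> (u *\<^sub>R x + v *\<^sub>R y)) $ i \<le> A j (u *\<^sub>R w + v *\<^sub>R z) $ i" for i
    proof -
      have "(A j (\<Phi> (u *\<^sub>R x + v *\<^sub>R y)) + b j) $ i
          \<le> u * (A j (\<Phi> x) + b j) $ i + v * (A j (\<Phi> y) + b j) $ i"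
        using cvx[OF that, of i] uv unfolding convex_on_def by auto
      \<comment> \<open>The offsets add up to \<open>b j\<close> since \<open>u + v = 1\<close>, and
        so cancel.\<close>
      also have "\<dots> = u * A j (\<Phi> x) $ i + v * A j (\<Phi> y) $ i + (u + v) * b j $ i"
        by (simp add: algebra_simps)
      finally have "A j (\<Phi> (u *\<^sub>R x + v *\<^sub>R y)) $ i \<le> u * A j (\<Phi> x) $ i + v * A j (\<Phi> y) $ i"
        using uv by simp
      also have "\<dots> \<le> u * A j w $ i + v * A j z $ i"
        using x(3)[OF that] y(3)[OF that] uv
        by (intro add_mono mult_left_mono) (auto simp: less_eq_vec_def)
      also have "\<dots> = A j (u *\<^sub>R w + v *\<^sub>R z) $ i"
        using lin[OF that] by (simp add: linear_add linear_scale)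
      finally show ?thesis .
    qed
    then show ?thesis by (simp add: less_eq_vec_def)
  qed
  ultimately show "u *\<^sub>R w + v *\<^sub>R z \<in> {w. \<exists>x\<in>X. c \<bullet> x < \<gamma> \<and> (\<forall>j\<in>J. A j (\<Phi> x) \<le> A j w)}"
    by blast
qed

lemma convex_affine_le_0:
  fixes f :: "'w::real_vector \<Rightarrow> real^'r"
  assumes "linear f"
  shows "convex {w. f w + b \<le> 0}"
proof -
  have "y + b \<le> 0 \<longleftrightarrow> y \<le> - b" for y
    by (simp add: less_eq_vec_def le_diff_eq[symmetric])
  then have "{w. f w + b \<le> 0} = f -` {y. y \<le> - b}"
    by auto
  moreover have "convex {y. y \<le> - b}"
    by (rule convexI) (simp add: less_eq_vec_def convex_bound_le del: vector_uminus_component)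
  ultimately show ?thesis
    using assms by (metis convex_linear_vimage)
qed

text \<open>With \<open>DIM('w) + 1\<close> support constraints, their sets \<open>C k\<close> and
  one set \<open>B\<close> for all the rest would be \<open>DIM('w) + 2\<close> convex sets.
  Dropping \<open>B\<close> leaves \<open>\<Phi> x0\<close>, dropping \<open>C k\<close> leaves
  \<open>\<Phi> (y k)\<close>, so Helly gives a point common to all, hence a feasible point cheaper
  than the optimum.\<close>

lemma card_support_constraints_le_DIM:
  fixes \<Phi> :: "real^'n \<Rightarrow> 'w::euclidean_space" and A :: "nat \<Rightarrow> 'w \<Rightarrow> real^'r"
  assumes "finite J" "convex X"
    and lin: "\<And>j. j \<in> J \<Longrightarrow> linear (A j)"
    and g: "\<And>x j. j \<in> J \<Longrightarrow> g x (\<omega> j) = A j (\<Phi> x) + b j"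
    and cvx: "\<And>j i. j \<in> J \<Longrightarrow> convex_on UNIV (\<lambda>x. g x (\<omega> j) $ i)"
  shows "card (support_constraints c X g J \<omega>) \<le> DIM('w)"
proof (rule ccontr)
  assume "\<not> ?thesis"
  then obtain S where S: "S \<subseteq> support_constraints c X g J \<omega>" "card S = DIM('w) + 1"
    by (metis Suc_eq_plus1 not_less_eq_eq obtain_subset_with_card_n)
  then have "S \<subseteq> J" by (auto simp: support_constraints_def)
  have "finite S" using \<open>S \<subseteq> J\<close> \<open>finite J\<close> finite_subset by blast
  have "S \<noteq> {}" using S(2) by auto
  then obtain x0 where x0: "scenario_minimizer c X g J \<omega> x0"
    using S(1) by (auto simp: support_constraints_def)
  have feas: "x0 \<in> X" "\<And>j. j \<in> J \<Longrightarrow> A j (\<Phi> x0) + b j \<le> 0"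
    using x0 g by (auto simp: scenario_minimizer_def is_arg_min_def scenario_feasible_def)
  have opt: False if "x \<in> X" "\<And>j. j \<in> J \<Longrightarrow> A j (\<Phi> x) + b j \<le> 0" "c \<bullet> x < c \<bullet> x0" for x
    using x0 that g by (auto simp: scenario_minimizer_def is_arg_min_def scenario_feasible_def)
  have "\<exists>x\<in>X. c \<bullet> x < c \<bullet> x0 \<and> (\<forall>j\<in>J - {k}. A j (\<Phi> x) + b j \<le> 0)" if "k \<in> S" for k
  proof -
    obtain x xk where "scenario_minimizer c X g J \<omega> x"
      and xk: "scenario_minimizer c X g (J - {k}) \<omega> xk" and "c \<bullet> xk < c \<bullet> x"
      using \<open>k \<in> S\<close> S(1) unfolding support_constraints_def by blast
    then have "c \<bullet> xk < c \<bullet> x0"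
      using x0 unfolding scenario_minimizer_def is_arg_min_def by force
    then show ?thesis
      using xk g by (auto simp: scenario_minimizer_def is_arg_min_def scenario_feasible_def)
  qed
  then obtain y where y: "\<And>k. k \<in> S \<Longrightarrow> y k \<in> X" "\<And>k. k \<in> S \<Longrightarrow> c \<bullet> y k < c \<bullet> x0"
      "\<And>k j. k \<in> S \<Longrightarrow> j \<in> J \<Longrightarrow> j \<noteq> k \<Longrightarrow> A j (\<Phi> (y k)) + b j \<le> 0"
    by (metis Diff_iff empty_iff insert_iff)
  define C where "C k = {w. A k w + b k \<le> 0}" for k
  \<comment> \<open>The cost bound and all constraints outside \<open>S\<close> go into a single
    set, so that it counts only once. The relaxation still compares at every
    \<open>j \<in> J\<close>, including \<open>S\<close>, so that a witness inherits the constraints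
    of \<open>C k\<close> too.\<close>
  define B where "B = {w. \<exists>x\<in>X. c \<bullet> x < c \<bullet> x0 \<and> (\<forall>j\<in>J. A j (\<Phi> x) \<le> A j w)}
    \<inter> (\<Inter>j\<in>J - S. C j)"
  have "\<Phi> x0 \<in> C k" if "k \<in> J" for k
    using feas that by (simp add: C_def)
  have yC: "\<Phi> (y k) \<in> C j" if "k \<in> S" "j \<in> J" "j \<noteq> k" for k j
    using y that by (simp add: C_def)
  \<comment> \<open>The witness is \<open>y k\<close> itself; it may violate only constraint
    \<open>k\<close>, which lies in \<open>S\<close>.\<close>
  have yB: "\<Phi> (y k) \<in> B" if "k \<in> S" for k
    using y that \<open>S \<subseteq> J\<close> by (auto simp: B_def intro!: yC)
  have disj: "B \<inter> (\<Inter>k\<in>S. C k) = {}"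
  proof (rule equals0I)
    fix w assume w: "w \<in> B \<inter> (\<Inter>k\<in>S. C k)"
    then obtain x where x: "x \<in> X" "c \<bullet> x < c \<bullet> x0" "\<And>j. j \<in> J \<Longrightarrow> A j (\<Phi> x) \<le> A j w"
      by (auto simp: B_def)
    have "A j w + b j \<le> 0" if "j \<in> J" for j
      using w that by (cases "j \<in> S") (auto simp: B_def C_def)
    then have "A j (\<Phi> x) + b j \<le> 0" if "j \<in> J" for j
      using x(3)[OF that] that by (meson add_right_mono order_trans)
    then show False using opt x by blast
  qed
  have yN: "\<Phi> (y k) \<notin> C k" if "k \<in> S" for k
  proof
    assume "\<Phi> (y k) \<in> C k"
    then have "\<Phi> (y k) \<in> B \<inter> (\<Inter>k\<in>S. C k)"
      using yB yC that \<open>S \<subseteq> J\<close> by fastforce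
    then show False using disj by blast
  qed
  \<comment> \<open>Helly is applied to a set of sets, so coinciding members would spoil the count.
    The point \<open>\<Phi> (y k)\<close> lies in \<open>B\<close> and in every other
    \<open>C j\<close>, but not in \<open>C k\<close>.\<close>
  have "inj_on C S"
    using yC yN \<open>S \<subseteq> J\<close> by (metis inj_onI subsetD)
  have "B \<notin> C ` S"
    using yB yN by blast
  define F where "F = insert B (C ` S)"
  have "\<Inter>F \<noteq> {}"
  proof (rule Inter_nonempty_of_deletions)
    show "card F = DIM('w) + 2"
      using \<open>B \<notin> C ` S\<close> \<open>inj_on C S\<close> \<open>finite S\<close> S(2) by (simp add: F_def card_image)
    have convC: "convex (C k)" if "k \<in> J" for k
      using convex_affine_le_0[OF lin[OF that]] by (simp add: C_def)
    moreover have "convex B"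
      unfolding B_def
    proof (intro convex_Int convex_INT)
      show "convex {w. \<exists>x\<in>X. c \<bullet> x < c \<bullet> x0 \<and> (\<forall>j\<in>J. A j (\<Phi> x) \<le> A j w)}"
        using cvx g by (intro convex_relaxation[OF \<open>convex X\<close> lin, where b = b]) auto
    qed (use convC in auto)
    ultimately show "convex D" if "D \<in> F" for D
      using that \<open>S \<subseteq> J\<close> by (auto simp: F_def)
    show "\<Inter>(F - {D}) \<noteq> {}" if D: "D \<in> F" for D
    proof (cases "D = B")
      case True
      then have "\<Phi> x0 \<in> \<Inter>(F - {D})"
        using \<open>\<And>k. k \<in> J \<Longrightarrow> \<Phi> x0 \<in> C k\<close> \<open>S \<subseteq> J\<close> by (auto simp: F_def)
      then show ?thesis by blast
    next
      case False
      then obtain k where "k \<in> S" "D = C k" using D by (auto simp: F_def)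
      then have "\<Phi> (y k) \<in> \<Inter>(F - {D})"
        using yB yC \<open>S \<subseteq> J\<close> by (auto simp: F_def)
      then show ?thesis by blast
    qed
  qed
  then show False using disj by (simp add: F_def)
qed

theorem lemma1:
  fixes M :: "(real^'d) measure"
    and X :: "(real^'n) set" and c :: "real^'n"
    and g :: "real^'n \<Rightarrow> real^'d \<Rightarrow> real^'r"
    and G :: "real^'n \<Rightarrow> real^'m^'r" and q :: "real^'d \<Rightarrow> real^'m"
    and H :: "real^'n \<Rightarrow> real^'r" and s :: "real^'d \<Rightarrow> real^'r"
    and N :: nat
  assumes "prob_space M"
    and "compact X" and "convex X"
    and separable: "\<And>x \<delta>. \<delta> \<in> space M \<Longrightarrow> g x \<delta> = G x *v q \<delta> + H x + s \<delta>"
    and convex_lsc: "AE \<delta> in M. \<forall>i. convex_on UNIV (\<lambda>x. g x \<delta> $ i) \<and>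
                                      lower_semicontinuous (\<lambda>x. g x \<delta> $ i)"
    and feasible: "\<And>K::nat. K \<ge> 1 \<Longrightarrow>
           AE \<omega> in PiM {1..K} (\<lambda>_. M). scenario_feasible X g {1..K} \<omega> \<noteq> {}"
    and unique: "\<And>K::nat. K \<ge> 1 \<Longrightarrow>
           AE \<omega> in PiM {1..K} (\<lambda>_. M). \<exists>!x. scenario_minimizer c X g {1..K} \<omega> x"
    and measurable: "\<And>x. x \<in> X \<Longrightarrow> (\<lambda>\<delta>. g x \<delta>) \<in> borel_measurable M"
  shows "AE \<omega> in PiM {1..N} (\<lambda>_. M).
           card (support_constraints c X g {1..N} \<omega>) \<le> CARD('r) * (CARD('m) + 1)"
proof -
  have "AE \<delta> in M. \<delta> \<in> space M \<and> (\<forall>i. convex_on UNIV (\<lambda>x. g x \<delta> $ i))"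
    using convex_lsc AE_space by eventually_elim auto
  \<comment> \<open>Each coordinate has law \<open>M\<close>, and finitely many null sets are
    discarded.\<close>
  then have "AE \<omega> in PiM {1..N} (\<lambda>_. M).
      \<forall>j\<in>{1..N}. \<omega> j \<in> space M \<and> (\<forall>i. convex_on UNIV (\<lambda>x. g x (\<omega> j) $ i))"
    using \<open>prob_space M\<close> by (intro AE_finite_allI AE_PiM_component) auto
  then show ?thesis
  proof eventually_elim
    case (elim \<omega>)
    \<comment> \<open>The new variable is a pair of an r by m matrix and an r-vector, of dimension
      rm + r = r(m + 1); \<open>s (\<omega> j)\<close> is the offset \<open>b j\<close>.\<close>
    have "card (support_constraints c X g {1..N} \<omega>) \<le> DIM((real^'m^'r) \<times> (real^'r))"
    proof (rule card_support_constraints_le_DIM)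
      show "linear (\<lambda>(U, v). U *v q (\<omega> j) + v)" for j
        by (auto intro!: linearI
            simp: matrix_vector_mult_add_rdistrib scaleR_matrix_vector_assoc scaleR_add_right)
      show "g x (\<omega> j) = (case (G x, H x) of (U, v) \<Rightarrow> U *v q (\<omega> j) + v) + s (\<omega> j)"
        if "j \<in> {1..N}" for x j
        using separable elim that by simp
    qed (use elim \<open>convex X\<close> in auto)
    then show ?case by (simp add: algebra_simps)
  qed
qed

end
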